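(* The minimum sum-rate $\alpha^*$ is $$\alpha^*=\max\Bigl\{\sum_{i\in\mathcal{I}}\frac{g(\mathcal{K}\setminus\mathcal{X}_i)}{|\mathcal{I}|-1} : \{\mathcal{X}_i\}_{i\in\mathcal{I}}\text{ a partition of }\mathcal{K}\text{ with }2\le|\mathcal{I}|\le K\Bigr\}$$ for PS-CDE systems, and $$\alpha^*=\max\Bigl\{\Bigl\lceil\sum_{i\in\mathcal{I}}\frac{g(\mathcal{K}\setminus\mathcal{X}_i)}{|\mathcal{I}|-1}\Bigr\rceil : \{\mathcal{X}_i\}_{i\in\mathcal{I}}\text{ a partition of }\mathcal{K}\text{ with }2\le|\mathcal{I}|\le K\Bigr\}$$ for NPS-CDE systems, where $\lceil y\rceil$ is the smallest integer that is no less than $y$.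
   Context: A cooperative data exchange (CDE) system consists of a finite packet set $\mathcal{P}=\{\mathbf{p}_1,\dots,\mathbf{p}_L\}$ of $L$ elements, a client set $\mathcal{K}=\{1,\dots,K\}$ with $K\ge 2$, and has-sets $\mathcal{H}_j\subseteq\mathcal{P}$ for $j\in\mathcal{K}$ satisfying $\bigcup_{j\in\mathcal{K}}\mathcal{H}_j=\mathcal{P}$. Write $\mathcal{H}_j^c=\mathcal{P}\setminus\mathcal{H}_j$. For every proper subset $\mathcal{X}\subsetneq\mathcal{K}$ (possibly empty) define $$g(\mathcal{X})=\Bigl|\bigcap_{j\in\mathcal{K}\setminus\mathcal{X}}\mathcal{H}_j^c\Bigr| .$$ For $\mathbf{r}=(r_1,\dots,r_K)$ and $\mathcal{X}\subseteq\mathcal{K}$ write $\mathbf{r}(\mathcal{X})=\sum_{j\in\mathcal{X}}r_j$. For a system allowing packet splitting (PS-CDE system) and real $\alpha\ge0$, define $$\mathcal{R}_\alpha=\{\mathbf{r}\in\mathbb{R}_{+}^K : \mathbf{r}(\mathcal{X})\ge g(\mathcal{X})\ \text{for all } \mathcal{X}\subsetneq\mathcal{K},\ \mathbf{r}(\mathcal{K})=\alpha\},$$ where $\mathbb{R}_+$ denotes the nonnegative reals. For a system not allowing packet splitting (NPS-CDE system) and integer $\alpha\ge0$, $\mathcal{R}_\alpha$ is defined in the same way with $\mathbf{r}\in\mathbb{R}_+^K$ replaced by $\mathbf{r}\in\mathbb{N}_0^K$ (vectors of nonnegative integers). The minimum sum-rate $\alpha^*$ is the smallest $\alpha$ (a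 nonnegative real for PS-CDE, a nonnegative integer for NPS-CDE) such that $\mathcal{R}_\alpha$ is nonempty. A partition $\{\mathcal{X}_i\}_{i\in\mathcal{I}}$ of $\mathcal{K}$ is a family of nonempty, pairwise disjoint sets whose union is $\mathcal{K}$. *)

theory Defs
  imports "HOL-Analysis.Analysis" "HOL-Library.Disjoint_Sets" "HOL-Library.FuncSet"
begin

definition cde_system :: "'p set \<Rightarrow> nat \<Rightarrow> (nat \<Rightarrow> 'p set) \<Rightarrow> bool" where
  "cde_system P K H \<longleftrightarrow>
     finite P \<and> 2 \<le> K \<and> (\<forall>j\<in>{1..K}. H j \<subseteq> P) \<and> (\<Union>j\<in>{1..K}. H j) = P"

text \<open>Only meaningful for proper subsets X of the client set: for other X the
  intersection is over the empty family.\<close>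

definition cde_g :: "'p set \<Rightarrow> nat \<Rightarrow> (nat \<Rightarrow> 'p set) \<Rightarrow> nat set \<Rightarrow> nat" where
  "cde_g P K H X = card (\<Inter>j\<in>{1..K} - X. P - H j)"

text \<open>Vectors indexed by the clients are extensional functions on \<open>{1..K}\<close>.\<close>

definition ps_rates :: "'p set \<Rightarrow> nat \<Rightarrow> (nat \<Rightarrow> 'p set) \<Rightarrow> real \<Rightarrow> (nat \<Rightarrow> real) set" where
  "ps_rates P K H \<alpha> =
     {r \<in> {1..K} \<rightarrow>\<^sub>E {0..}.
        (\<forall>X. X \<subset> {1..K} \<longrightarrow> (\<Sum>j\<in>X. r j) \<ge> real (cde_g P K H X)) \<and>
        (\<Sum>j\<in>{1..K}. r j) = \<alpha>}"

definition nps_rates :: "'p set \<Rightarrow> nat \<Rightarrow> (nat \<Rightarrow> 'p set) \<Rightarrow> nat \<Rightarrow> (nat \<Rightarrow> nat) set" where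
  "nps_rates P K H \<alpha> =
     {r \<in> {1..K} \<rightarrow>\<^sub>E UNIV.
        (\<forall>X. X \<subset> {1..K} \<longrightarrow> (\<Sum>j\<in>X. r j) \<ge> cde_g P K H X) \<and>
        (\<Sum>j\<in>{1..K}. r j) = \<alpha>}"

text \<open>The minimum sum-rate is given as a predicate, so that its existence is part of any claim
  asserting it of a particular number.\<close>

definition is_ps_min_sum_rate :: "'p set \<Rightarrow> nat \<Rightarrow> (nat \<Rightarrow> 'p set) \<Rightarrow> real \<Rightarrow> bool" where
  "is_ps_min_sum_rate P K H \<alpha> \<longleftrightarrow>
     0 \<le> \<alpha> \<and> ps_rates P K H \<alpha> \<noteq> {} \<and>
     (\<forall>\<beta>. 0 \<le> \<beta> \<longrightarrow> ps_rates P K H \<beta> \<noteq> {} \<longrightarrow> \<alpha> \<le> \<beta>)"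

definition is_nps_min_sum_rate :: "'p set \<Rightarrow> nat \<Rightarrow> (nat \<Rightarrow> 'p set) \<Rightarrow> nat \<Rightarrow> bool" where
  "is_nps_min_sum_rate P K H \<alpha> \<longleftrightarrow>
     nps_rates P K H \<alpha> \<noteq> {} \<and>
     (\<forall>\<beta>. nps_rates P K H \<beta> \<noteq> {} \<longrightarrow> \<alpha> \<le> \<beta>)"

definition cde_partitions :: "nat \<Rightarrow> nat set set set" where
  "cde_partitions K = {Q. partition_on {1..K} Q \<and> 2 \<le> card Q \<and> card Q \<le> K}"

definition partition_value :: "'p set \<Rightarrow> nat \<Rightarrow> (nat \<Rightarrow> 'p set) \<Rightarrow> nat set set \<Rightarrow> real" where
  "partition_value P K H Q =
     (\<Sum>X\<in>Q. real (cde_g P K H ({1..K} - X)) / (real (card Q) - 1))"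

end

theory Submission
  imports Defs
begin

text \<open>Put \<open>V = {1..K}\<close> and \<open>h X = \<alpha> - g (V - X)\<close> for nonempty \<open>X\<close>. Taking complements, \<open>r\<close> is feasible
  iff \<open>r(V) = \<alpha>\<close> and \<open>r(X) \<le> h X\<close> for all nonempty \<open>X\<close>, and \<open>h\<close> is submodular on intersecting
  pairs. Starting from very negative rates, raise the coordinates one after the other
  until each lies in a tight set (\<open>r(X) = h X\<close>). Intersecting tight sets have a tight union, so the
  maximal tight sets partition \<open>V\<close>, and \<open>r(V)\<close> is the sum of \<open>h\<close> over this partition. Hence \<open>r(V) = h V = \<alpha>\<close>
  can be reached iff no partition has a smaller sum. The argument works over any ordered
  domain, so integral data give integral rates.\<close>

section \<open>Intersecting submodular functions and tight sets\<close>

lemma intersecting_submodular_saturated: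
  fixes h :: "'b set \<Rightarrow> 'a::linordered_idom"
  assumes "finite V"
  shows "\<exists>r. (\<forall>X. X \<noteq> {} \<longrightarrow> X \<subseteq> V \<longrightarrow> sum r X \<le> h X) \<and>
             (\<forall>j\<in>V. \<exists>X\<subseteq>V. j \<in> X \<and> sum r X = h X)"
proof -
  have "S \<subseteq> V \<Longrightarrow> \<exists>r. (\<forall>X. X \<noteq> {} \<longrightarrow> X \<subseteq> V \<longrightarrow> sum r X \<le> h X) \<and>
             (\<forall>j\<in>S. \<exists>X\<subseteq>V. j \<in> X \<and> sum r X = h X)" if "finite S" for S
    using that
  proof (induction S rule: finite_induct)
    case empty
    \<comment> \<open>\<open>M\<close> dominates every \<open>\<bar>h X\<bar>\<close>. With all
      rates equal to \<open>- M\<close>, a nonempty \<open>X\<close> has sum at most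
      \<open>- M\<close>, hence at most \<open>h X\<close>.\<close>
    define M where "M = (\<Sum>X\<in>Pow V. \<bar>h X\<bar>)"
    have M: "0 \<le> M" unfolding M_def by (rule sum_nonneg) simp
    have "sum (\<lambda>_. - M) X \<le> h X" if "X \<noteq> {}" "X \<subseteq> V" for X
    proof -
      have "finite X" using that assms finite_subset by blast
      then have "1 \<le> card X" using that by (simp add: Suc_le_eq card_gt_0_iff)
      then have "(1::'a) \<le> of_nat (card X)" by (metis of_nat_1 of_nat_le_iff)
      then have "M \<le> of_nat (card X) * M" using mult_right_mono[OF _ M] by fastforce
      moreover have "\<bar>h X\<bar> \<le> M"
        unfolding M_def using that assms by (intro member_le_sum) auto
      ultimately show ?thesis by simp
    qed
    then show ?case by (intro exI[of _ "\<lambda>_. - M"]) auto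
  next
    case (insert j S)
    then have "S \<subseteq> V" by simp
    from insert.IH[OF this]
    obtain r where r0: "\<forall>X. X \<noteq> {} \<longrightarrow> X \<subseteq> V \<longrightarrow> sum r X \<le> h X"
      and tight: "\<forall>i\<in>S. \<exists>X\<subseteq>V. i \<in> X \<and> sum r X = h X" by (elim exE conjE)
    have r: "sum r X \<le> h X" if "X \<noteq> {}" "X \<subseteq> V" for X using r0 that by simp
    define F where "F = {X. X \<subseteq> V \<and> j \<in> X}"
    \<comment> \<open>The largest raise of coordinate \<open>j\<close> that violates no constraint:
      only sets containing \<open>j\<close> are affected, and a minimiser \<open>D\<close> becomes
      tight.\<close>
    define d where "d = Min ((\<lambda>X. h X - sum r X) ` F)"
    have "finite F" using assms unfolding F_def by simp
    moreover have "V \<in> F" using insert.prems unfolding F_def by simp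
    ultimately have "d \<in> (\<lambda>X. h X - sum r X) ` F"
      unfolding d_def by (intro Min_in) auto
    then obtain D where D: "D \<in> F" "d = h D - sum r D" by auto
    have d_le: "d \<le> h X - sum r X" if "X \<in> F" for X
      unfolding d_def using that \<open>finite F\<close> by (intro Min_le) auto
    have "0 \<le> d" using D r[of D] unfolding F_def by auto
    define s where "s = r(j := r j + d)"
    have s: "sum s X = sum r X + (if j \<in> X then d else 0)" if "X \<subseteq> V" for X
    proof -
      have fX: "finite X" using that assms finite_subset by blast
      have "sum s X = (\<Sum>i\<in>X. r i + (if i = j then d else 0))"
        unfolding s_def by (intro sum.cong) auto
      then show ?thesis using fX by (simp add: sum.distrib)
    qed
    have "sum s X \<le> h X" if "X \<noteq> {}" "X \<subseteq> V" for X
      using s[OF that(2)] r[OF that] d_le[of X] that(2) unfolding F_def by (auto split: if_splits)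
    moreover have "\<exists>X\<subseteq>V. i \<in> X \<and> sum s X = h X" if i: "i \<in> insert j S" for i
    proof (cases "i = j")
      case True
      then show ?thesis using D s[of D] unfolding F_def by (intro exI[of _ D]) auto
    next
      case False
      then obtain X where X: "X \<subseteq> V" "i \<in> X" "sum r X = h X" using i tight by auto
      \<comment> \<open>Tightness already gained survives: a tight set containing \<open>j\<close>
        has slack 0, so it forces the raise to be 0.\<close>
      have "d = 0" if "j \<in> X" using d_le[of X] that X \<open>0 \<le> d\<close> unfolding F_def by auto
      then show ?thesis using X s[of X] by (intro exI[of _ X]) auto
    qed
    ultimately show ?case by (intro exI[of _ s]) simp
  qed
  from this[OF assms order_refl] show ?thesis .
qed

lemma sum_Union_partition_on:
  assumes "finite A" "partition_on A Q"
  shows "sum f A = (\<Sum>X\<in>Q. sum f X)"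
proof -
  have "\<forall>X\<in>Q. finite X" using assms partition_onD1 by (auto intro: finite_subset)
  then have "sum f (\<Union>Q) = (\<Sum>X\<in>Q. sum f X)"
    using partition_onD2[OF assms(2)] by (subst sum.Union_disjoint) (auto simp: disjoint_def)
  then show ?thesis using partition_onD1[OF assms(2)] by simp
qed

lemma intersecting_submodular_base:
  fixes h :: "'b set \<Rightarrow> 'a::linordered_idom"
  assumes V: "finite V" "V \<noteq> {}"
    and submod: "\<And>X Y. X \<subseteq> V \<Longrightarrow> Y \<subseteq> V \<Longrightarrow> X \<inter> Y \<noteq> {} \<Longrightarrow> h (X \<union> Y) + h (X \<inter> Y) \<le> h X + h Y"
    and parts: "\<And>Q. partition_on V Q \<Longrightarrow> h V \<le> sum h Q"
  shows "\<exists>r. (\<forall>X. X \<noteq> {} \<longrightarrow> X \<subseteq> V \<longrightarrow> sum r X \<le> h X) \<and> sum r V = h V"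
proof -
  obtain r where r0: "\<forall>X. X \<noteq> {} \<longrightarrow> X \<subseteq> V \<longrightarrow> sum r X \<le> h X"
    and tight: "\<forall>j\<in>V. \<exists>X\<subseteq>V. j \<in> X \<and> sum r X = h X"
    using intersecting_submodular_saturated[OF V(1), of h] by (elim exE conjE)
  have r: "sum r X \<le> h X" if "X \<noteq> {}" "X \<subseteq> V" for X using r0 that by simp
  define T where "T = {X. X \<noteq> {} \<and> X \<subseteq> V \<and> sum r X = h X}"
  define Q where "Q = {X\<in>T. \<forall>Y\<in>T. X \<subseteq> Y \<longrightarrow> X = Y}"
  have finT: "finite T" unfolding T_def using V by (auto intro: finite_subset[of _ "Pow V"])
  \<comment> \<open>Uncrossing. The sums over union and intersection add up to
    \<open>h X + h Y\<close>, while each is bounded by its value of \<open>h\<close>; submodularity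
    leaves no slack in either bound. That \<open>X\<close> and \<open>Y\<close> meet is what makes
    the constraint on \<open>X \<inter> Y\<close> available.\<close>
  have Un: "X \<union> Y \<in> T" if "X \<in> T" "Y \<in> T" "X \<inter> Y \<noteq> {}" for X Y
  proof -
    have XY: "X \<subseteq> V" "Y \<subseteq> V" "sum r X = h X" "sum r Y = h Y" using that unfolding T_def by auto
    have "finite X" "finite Y" using XY V finite_subset by blast+
    then have "sum r (X \<union> Y) + sum r (X \<inter> Y) = h X + h Y"
      using sum.union_inter[of X Y r] XY by simp
    moreover have "sum r (X \<inter> Y) \<le> h (X \<inter> Y)" "sum r (X \<union> Y) \<le> h (X \<union> Y)"
      using r[of "X \<inter> Y"] r[of "X \<union> Y"] XY that(3) by blast+
    moreover note submod[OF XY(1,2) that(3)]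
    ultimately have "sum r (X \<union> Y) = h (X \<union> Y)" by linarith
    then show ?thesis using XY that(3) unfolding T_def by blast
  qed
  have Q: "partition_on V Q"
  proof (rule partition_onI)
    show "\<Union>Q = V"
    proof
      show "\<Union>Q \<subseteq> V" unfolding Q_def T_def by auto
      show "V \<subseteq> \<Union>Q"
      proof
        fix j assume "j \<in> V"
        then obtain X where X: "X \<in> T" "j \<in> X" using tight unfolding T_def by blast
        then obtain Y where "Y \<in> T" "X \<subseteq> Y" "\<forall>Z\<in>T. Y \<subseteq> Z \<longrightarrow> Y = Z"
          using finite_has_maximal2[OF finT X(1)] by metis
        then show "j \<in> \<Union>Q" using X(2) unfolding Q_def by auto
      qed
    qed
    show "disjnt X Y" if XY: "X \<in> Q" "Y \<in> Q" "X \<noteq> Y" for X Y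
    proof (rule ccontr)
      assume "\<not> disjnt X Y"
      then have "X \<union> Y \<in> T" using Un XY unfolding Q_def disjnt_def by simp
      then have "X = X \<union> Y" "Y = X \<union> Y" using XY unfolding Q_def by auto
      then show False using XY(3) by simp
    qed
    show "{} \<notin> Q" unfolding Q_def T_def by simp
  qed
  have "sum r (\<Union>Q) = (\<Sum>X\<in>Q. sum r X)"
    using sum_Union_partition_on[OF V(1) Q] partition_onD1[OF Q] by simp
  also have "\<dots> = sum h Q" unfolding Q_def T_def by (intro sum.cong) auto
  finally have "sum r V = sum h Q" using partition_onD1[OF Q] by simp
  \<comment> \<open>\<open>parts\<close> gives \<open>h V \<le> sum r V\<close>; the constraint on
    \<open>V\<close> itself gives the converse.\<close>
  then have "sum r V = h V" using parts[OF Q] r[of V] V by simp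
  then show ?thesis using r by (intro exI[of _ r]) simp
qed

text \<open>Choosing one element from each block is injective because blocks are disjoint. This
  supplies the upper bound on the number of blocks in \<open>cde_partitions\<close>.\<close>

lemma card_partition_on_le:
  assumes "finite A" "partition_on A Q"
  shows "card Q \<le> card A"
proof -
  have "\<exists>f. \<forall>X\<in>Q. f X \<in> X"
    using partition_onD3[OF assms(2)] by (intro bchoice) (metis ex_in_conv)
  then obtain f where f: "\<And>X. X \<in> Q \<Longrightarrow> f X \<in> X" by blast
  have "inj_on f Q"
    using f partition_onD2[OF assms(2)] by (intro inj_onI) (metis disjointD disjoint_iff)
  moreover have "f ` Q \<subseteq> A" using f partition_onD1[OF assms(2)] by blast
  ultimately show ?thesis using card_inj_on_le assms(1) by blast
qed

section \<open>Supermodularity of g and the partition criterion\<close>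

lemma cde_g_compl:
  assumes "X \<subseteq> {1..K}"
  shows "cde_g P K H ({1..K} - X) = card (\<Inter>j\<in>X. P - H j)"
  using assms unfolding cde_g_def by (simp add: double_diff)

text \<open>Let \<open>?G X\<close> be the packets missing at every client in \<open>X\<close>. Then
  \<open>?G X \<inter> ?G Y\<close> equals \<open>?G (X \<union> Y)\<close>, while
  \<open>?G X \<union> ?G Y\<close> is only contained in \<open>?G (X \<inter> Y)\<close>; counting
  gives the inequality. Since \<open>X\<close> and \<open>Y\<close> meet,
  \<open>?G (X \<inter> Y)\<close> lies in \<open>P\<close> and is finite; over an empty index set
  it would be the whole type.\<close>

lemma cde_g_compl_supermodular:
  assumes "finite P" "X \<subseteq> {1..K}" "Y \<subseteq> {1..K}" "X \<inter> Y \<noteq> {}"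
  shows "cde_g P K H ({1..K} - X) + cde_g P K H ({1..K} - Y)
       \<le> cde_g P K H ({1..K} - (X \<union> Y)) + cde_g P K H ({1..K} - (X \<inter> Y))"
proof -
  let ?G = "\<lambda>X. \<Inter>j\<in>X. P - H j"
  have fin: "finite (?G Z)" if "Z \<noteq> {}" for Z
    using that assms(1) by (auto intro: finite_subset[of _ P])
  have "card (?G X) + card (?G Y) = card (?G X \<union> ?G Y) + card (?G X \<inter> ?G Y)"
    using assms(4) fin by (intro card_Un_Int) auto
  also have "?G X \<inter> ?G Y = ?G (X \<union> Y)" by blast
  also have "card (?G X \<union> ?G Y) \<le> card (?G (X \<inter> Y))"
    using fin[OF assms(4)] by (intro card_mono) auto
  finally have "card (?G X) + card (?G Y) \<le> card (?G (X \<inter> Y)) + card (?G (X \<union> Y))"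
    by simp
  moreover have "X \<union> Y \<subseteq> {1..K}" "X \<inter> Y \<subseteq> {1..K}" using assms by auto
  ultimately show ?thesis using assms(2,3) by (simp only: cde_g_compl add.commute)
qed

text \<open>The denominator is multiplied out so that one proof serves both \<open>real\<close> and
  \<open>int\<close>. For necessity, add the constraints on the complements of the blocks: each rate
  is counted \<open>card Q - 1\<close> times. For sufficiency, the partition bounds are the
  hypothesis \<open>parts\<close> of \<open>intersecting_submodular_base\<close>.\<close>

lemma feasible_iff_partitions:
  fixes \<alpha> :: "'a::linordered_idom"
  assumes "cde_system P K H"
  shows "(\<exists>r. (\<forall>X. X \<subset> {1..K} \<longrightarrow> of_nat (cde_g P K H X) \<le> sum r X) \<and> sum r {1..K} = \<alpha>) \<longleftrightarrow>
         (\<forall>Q\<in>cde_partitions K. (\<Sum>X\<in>Q. of_nat (cde_g P K H ({1..K} - X))) \<le> (of_nat (card Q) - 1) * \<alpha>)"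
    (is "?L \<longleftrightarrow> ?R")
proof
  assume ?L
  then obtain r where r: "\<And>X. X \<subset> {1..K} \<Longrightarrow> of_nat (cde_g P K H X) \<le> sum r X"
    and sum: "sum r {1..K} = \<alpha>" by blast
  show ?R
  proof
    fix Q assume "Q \<in> cde_partitions K"
    then have Q: "partition_on {1..K} Q" unfolding cde_partitions_def by auto
    then have sub: "X \<noteq> {}" "X \<subseteq> {1..K}" if "X \<in> Q" for X
      using that partition_onD1[OF Q] partition_onD3[OF Q] by auto
    have "(\<Sum>X\<in>Q. of_nat (cde_g P K H ({1..K} - X))) \<le> (\<Sum>X\<in>Q. \<alpha> - sum r X)"
    proof (rule sum_mono)
      fix X assume X: "X \<in> Q"
      have "of_nat (cde_g P K H ({1..K} - X)) \<le> sum r ({1..K} - X)"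
        using sub[OF X] by (intro r) auto
      also have "\<dots> = \<alpha> - sum r X"
        using sub[OF X] sum by (subst sum_diff) auto
      finally show "of_nat (cde_g P K H ({1..K} - X)) \<le> \<alpha> - sum r X" .
    qed
    also have "\<dots> = of_nat (card Q) * \<alpha> - (\<Sum>X\<in>Q. sum r X)"
      by (simp add: sum_subtractf)
    also have "(\<Sum>X\<in>Q. sum r X) = \<alpha>"
      using sum_Union_partition_on[OF _ Q, of r] sum by simp
    finally show "(\<Sum>X\<in>Q. of_nat (cde_g P K H ({1..K} - X))) \<le> (of_nat (card Q) - 1) * \<alpha>"
      by (simp add: algebra_simps)
  qed
next
  assume R: ?R
  define V where "V = {1..K}"
  have fin: "finite P" and K: "2 \<le> K" and HP: "(\<Union>j\<in>{1..K}. H j) = P"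
    using assms unfolding cde_system_def by auto
  have V: "finite V" "V \<noteq> {}" using K unfolding V_def by auto
  define h where "h X = \<alpha> - of_nat (cde_g P K H (V - X))" for X
  \<comment> \<open>The has-sets cover \<open>P\<close>, so no packet is missing everywhere. Thus
    \<open>h V\<close> is exactly the prescribed total rate.\<close>
  have "(\<Inter>j\<in>V. P - H j) = {}" using HP V(2) unfolding V_def by blast
  then have hV: "h V = \<alpha>"
    using cde_g_compl[of V K P H] unfolding h_def V_def by simp
  have "\<exists>r. (\<forall>X. X \<noteq> {} \<longrightarrow> X \<subseteq> V \<longrightarrow> sum r X \<le> h X) \<and> sum r V = h V"
  proof (rule intersecting_submodular_base[OF V])
    fix X Y assume "X \<subseteq> V" "Y \<subseteq> V" "X \<inter> Y \<noteq> {}"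
    then have "cde_g P K H (V - X) + cde_g P K H (V - Y)
       \<le> cde_g P K H (V - (X \<union> Y)) + cde_g P K H (V - (X \<inter> Y))"
      unfolding V_def using fin by (intro cde_g_compl_supermodular)
    then have "of_nat (cde_g P K H (V - X) + cde_g P K H (V - Y))
       \<le> (of_nat (cde_g P K H (V - (X \<union> Y)) + cde_g P K H (V - (X \<inter> Y))) :: 'a)"
      by (rule of_nat_mono)
    then show "h (X \<union> Y) + h (X \<inter> Y) \<le> h X + h Y" unfolding h_def by simp
  next
    fix Q assume Q: "partition_on V Q"
    have "finite Q" using Q V(1) finite_elements by blast
    show "h V \<le> sum h Q"
    \<comment> \<open>With at least two blocks, \<open>sum h Q\<close> is
      \<open>card Q * \<alpha>\<close> minus the sum of g, so the claim is \<open>?R\<close>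
      rearranged. The only other partition is \<open>{V}\<close>, where equality holds.\<close>
    proof (cases "2 \<le> card Q")
      case True
      moreover have "card Q \<le> K" using card_partition_on_le[OF V(1) Q] unfolding V_def by simp
      ultimately have "Q \<in> cde_partitions K" using Q unfolding cde_partitions_def V_def by simp
      then show ?thesis
        using R unfolding hV unfolding h_def V_def by (simp add: sum_subtractf algebra_simps)
    next
      case False
      moreover have "Q \<noteq> {}" using V(2) partition_onD1[OF Q] by blast
      ultimately have "card Q = 1" using \<open>finite Q\<close> card_gt_0_iff[of Q] by linarith
      then obtain X where "Q = {X}" using card_1_singletonE by blast
      then show ?thesis using partition_onD1[OF Q] by simp
    qed
  qed
  then obtain r where r: "\<And>X. X \<noteq> {} \<Longrightarrow> X \<subseteq> V \<Longrightarrow> sum r X \<le> h X" and sum: "sum r V = \<alpha>"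
    unfolding hV by blast
  have "of_nat (cde_g P K H X) \<le> sum r X" if X: "X \<subset> V" for X
  proof -
    \<comment> \<open>Back to lower bounds: \<open>X\<close> is proper, so its complement is
      nonempty and its upper bound applies; subtracting from the total returns the bound on
      \<open>X\<close>.\<close>
    have "sum r V - sum r X = sum r (V - X)" using X V by (subst sum_diff) auto
    also have "\<dots> \<le> h (V - X)" using X by (intro r) auto
    also have "h (V - X) = \<alpha> - of_nat (cde_g P K H X)"
      using X unfolding h_def by (simp add: double_diff)
    finally show ?thesis using sum by simp
  qed
  then show ?L using sum unfolding V_def by blast
qed

section \<open>Real and integral rate vectors\<close>

lemma feasible_nonneg:
  fixes r :: "nat \<Rightarrow> 'a::linordered_idom"
  assumes "2 \<le> K" "\<And>X. X \<subset> {1..K} \<Longrightarrow> of_nat (cde_g P K H X) \<le> sum r X" "j \<in> {1..K}"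
  shows "0 \<le> r j"
proof -
  \<comment> \<open>As \<open>K\<close> is at least 2, the singleton is a proper subset, so its own
    constraint bounds \<open>r j\<close> below by a cardinality. This is how nonnegative rates are
    recovered from the feasibility criterion.\<close>
  have "{j} \<noteq> {1..K}" using assms(1) by (metis card_atLeastAtMost card_1_singleton_iff
        One_nat_def diff_Suc_1 Suc_1 not_less_eq_eq le_refl)
  then have "of_nat (cde_g P K H {j}) \<le> r j" using assms(2)[of "{j}"] assms(3) by (simp add: psubset_eq)
  then show ?thesis using of_nat_0_le_iff order_trans by blast
qed

lemma partition_value_le_iff:
  assumes "Q \<in> cde_partitions K"
  shows "partition_value P K H Q \<le> \<alpha> \<longleftrightarrow>
         (\<Sum>X\<in>Q. real (cde_g P K H ({1..K} - X))) \<le> (real (card Q) - 1) * \<alpha>"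
proof -
  have "1 < real (card Q)" using assms unfolding cde_partitions_def by auto
  then show ?thesis
    unfolding partition_value_def by (simp add: sum_divide_distrib[symmetric] field_simps)
qed

lemma ps_rates_nonempty_iff:
  assumes "cde_system P K H"
  shows "ps_rates P K H \<alpha> \<noteq> {} \<longleftrightarrow> (\<forall>Q\<in>cde_partitions K. partition_value P K H Q \<le> \<alpha>)"
proof -
  have K: "2 \<le> K" using assms unfolding cde_system_def by auto
  have "ps_rates P K H \<alpha> \<noteq> {} \<longleftrightarrow>
      (\<exists>r. (\<forall>X. X \<subset> {1..K} \<longrightarrow> real (cde_g P K H X) \<le> sum r X) \<and> sum r {1..K} = \<alpha>)"
  proof
    assume "\<exists>r. (\<forall>X. X \<subset> {1..K} \<longrightarrow> real (cde_g P K H X) \<le> sum r X) \<and> sum r {1..K} = \<alpha>"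
    then obtain r where r: "\<And>X. X \<subset> {1..K} \<Longrightarrow> real (cde_g P K H X) \<le> sum r X"
      and sum: "sum r {1..K} = \<alpha>" by blast
    \<comment> \<open>Restriction makes the vector extensional, as \<open>ps_rates\<close> demands,
      and leaves all sums over clients unchanged.\<close>
    define s where "s = restrict r {1..K}"
    have eq: "sum s X = sum r X" if "X \<subseteq> {1..K}" for X
      unfolding s_def using that by (intro sum.cong) auto
    have "s \<in> {1..K} \<rightarrow>\<^sub>E {0..}"
      unfolding s_def using feasible_nonneg[OF K r] by auto
    moreover have "real (cde_g P K H X) \<le> sum s X" if "X \<subset> {1..K}" for X
      using r[OF that] eq[of X] that by simp
    moreover have "sum s {1..K} = \<alpha>" using eq[of "{1..K}"] sum by simp
    ultimately have "s \<in> ps_rates P K H \<alpha>" unfolding ps_rates_def by simp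
    then show "ps_rates P K H \<alpha> \<noteq> {}" by blast
  qed (auto simp: ps_rates_def)
  then show ?thesis
    using feasible_iff_partitions[OF assms, of \<alpha>] by (simp add: partition_value_le_iff)
qed

lemma nps_rates_nonempty_iff:
  assumes "cde_system P K H"
  shows "nps_rates P K H \<alpha> \<noteq> {} \<longleftrightarrow>
         (\<forall>Q\<in>cde_partitions K. \<lceil>partition_value P K H Q\<rceil> \<le> int \<alpha>)"
proof -
  have K: "2 \<le> K" using assms unfolding cde_system_def by auto
  have "nps_rates P K H \<alpha> \<noteq> {} \<longleftrightarrow>
      (\<exists>r. (\<forall>X. X \<subset> {1..K} \<longrightarrow> int (cde_g P K H X) \<le> sum r X) \<and> sum r {1..K} = int \<alpha>)"
  proof
    assume "nps_rates P K H \<alpha> \<noteq> {}"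
    then obtain r where "\<forall>X. X \<subset> {1..K} \<longrightarrow> cde_g P K H X \<le> sum r X" "sum r {1..K} = \<alpha>"
      unfolding nps_rates_def by auto
    then show "\<exists>r. (\<forall>X. X \<subset> {1..K} \<longrightarrow> int (cde_g P K H X) \<le> sum r X) \<and> sum r {1..K} = int \<alpha>"
      by (intro exI[of _ "\<lambda>j. int (r j)"]) (simp flip: of_nat_sum)
  next
    assume "\<exists>r. (\<forall>X. X \<subset> {1..K} \<longrightarrow> int (cde_g P K H X) \<le> sum r X) \<and> sum r {1..K} = int \<alpha>"
    then obtain r where r: "\<And>X. X \<subset> {1..K} \<Longrightarrow> int (cde_g P K H X) \<le> sum r X"
      and sum: "sum r {1..K} = int \<alpha>" by blast
    have nonneg: "0 \<le> r j" if "j \<in> {1..K}" for j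
      using feasible_nonneg[of K P H r j] K r that by simp
    \<comment> \<open>No value is truncated by \<open>nat\<close>, since the rates of all clients
      are nonnegative.\<close>
    define s where "s = restrict (\<lambda>j. nat (r j)) {1..K}"
    have eq: "int (sum s X) = sum r X" if "X \<subseteq> {1..K}" for X
      unfolding s_def of_nat_sum using that nonneg by (intro sum.cong) auto
    have "cde_g P K H X \<le> sum s X" if "X \<subset> {1..K}" for X
      using r[OF that] eq[of X] that by (metis of_nat_le_iff psubset_imp_subset)
    moreover have "sum s {1..K} = \<alpha>" using eq[of "{1..K}"] sum by (simp del: of_nat_sum)
    ultimately have "s \<in> nps_rates P K H \<alpha>" unfolding nps_rates_def s_def by simp
    then show "nps_rates P K H \<alpha> \<noteq> {}" by blast
  qed
  also have "\<dots> \<longleftrightarrow> (\<forall>Q\<in>cde_partitions K.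
      (\<Sum>X\<in>Q. int (cde_g P K H ({1..K} - X))) \<le> (int (card Q) - 1) * int \<alpha>)"
    using feasible_iff_partitions[OF assms, of "int \<alpha>"] by simp
  also have "\<dots> \<longleftrightarrow> (\<forall>Q\<in>cde_partitions K. \<lceil>partition_value P K H Q\<rceil> \<le> int \<alpha>)"
  proof (rule ball_cong[OF refl])
    fix Q assume Q: "Q \<in> cde_partitions K"
    \<comment> \<open>The integer inequality is moved to the reals, where division is possible. The
      ceiling then enters because the right-hand side is an integer.\<close>
    have "(\<Sum>X\<in>Q. int (cde_g P K H ({1..K} - X))) \<le> (int (card Q) - 1) * int \<alpha> \<longleftrightarrow>
        real_of_int (\<Sum>X\<in>Q. int (cde_g P K H ({1..K} - X))) \<le> real_of_int ((int (card Q) - 1) * int \<alpha>)"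
      by (simp only: of_int_le_iff)
    also have "\<dots> \<longleftrightarrow> partition_value P K H Q \<le> real \<alpha>"
      unfolding partition_value_le_iff[OF Q] by simp
    also have "\<dots> \<longleftrightarrow> \<lceil>partition_value P K H Q\<rceil> \<le> int \<alpha>"
      by (simp add: ceiling_le_iff)
    finally show "(\<Sum>X\<in>Q. int (cde_g P K H ({1..K} - X))) \<le> (int (card Q) - 1) * int \<alpha> \<longleftrightarrow>
        \<lceil>partition_value P K H Q\<rceil> \<le> int \<alpha>" .
  qed
  finally show ?thesis .
qed

section \<open>The maximum over partitions\<close>

lemma finite_cde_partitions: "finite (cde_partitions K)"
proof (rule finite_subset)
  show "cde_partitions K \<subseteq> Pow (Pow {1..K})"
    unfolding cde_partitions_def partition_on_def by auto
qed simp

text \<open>The partition into singletons is a witness; with finiteness this makes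
  \<open>Max\<close> meaningful.\<close>

lemma cde_partitions_nonempty:
  assumes "2 \<le> K"
  shows "cde_partitions K \<noteq> {}"
proof -
  have "partition_on {1..K} ((\<lambda>j. {j}) ` {1..K})"
    by (rule partition_onI) (auto simp: disjnt_def)
  moreover have "card ((\<lambda>j. {j}) ` {1..K}) = K" by (subst card_image) auto
  ultimately show ?thesis using assms unfolding cde_partitions_def by force
qed

lemma partition_value_nonneg:
  assumes "Q \<in> cde_partitions K"
  shows "0 \<le> partition_value P K H Q"
  using assms unfolding partition_value_def cde_partitions_def by (auto intro!: sum_nonneg)

theorem mainTheorem2:
  fixes P :: "'p set" and K :: nat and H :: "nat \<Rightarrow> 'p set"
  assumes "cde_system P K H"
  shows "(\<exists>!\<alpha>. is_ps_min_sum_rate P K H \<alpha>) \<and>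
         (\<forall>\<alpha>. is_ps_min_sum_rate P K H \<alpha> \<longrightarrow>
            \<alpha> = Max {partition_value P K H Q | Q. Q \<in> cde_partitions K}) \<and>
         (\<exists>!\<alpha>. is_nps_min_sum_rate P K H \<alpha>) \<and>
         (\<forall>\<alpha>. is_nps_min_sum_rate P K H \<alpha> \<longrightarrow>
            int \<alpha> = Max {\<lceil>partition_value P K H Q\<rceil> | Q. Q \<in> cde_partitions K})"
proof -
  let ?V = "{partition_value P K H Q | Q. Q \<in> cde_partitions K}"
  let ?C = "{\<lceil>partition_value P K H Q\<rceil> | Q. Q \<in> cde_partitions K}"
  have fin: "finite ?V" "finite ?C" using finite_cde_partitions[of K] by auto
  have "2 \<le> K" using assms unfolding cde_system_def by auto
  then have ne: "?V \<noteq> {}" "?C \<noteq> {}" using cde_partitions_nonempty[of K] by auto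
  \<comment> \<open>The feasible totals form an up-closed ray whose least element is the maximum, so
    existence, uniqueness and value of the minimum come together.\<close>
  have ps: "ps_rates P K H \<beta> \<noteq> {} \<longleftrightarrow> Max ?V \<le> \<beta>" for \<beta>
    unfolding ps_rates_nonempty_iff[OF assms] Max_le_iff[OF fin(1) ne(1)] by blast
  have nps: "nps_rates P K H \<beta> \<noteq> {} \<longleftrightarrow> Max ?C \<le> int \<beta>" for \<beta>
    unfolding nps_rates_nonempty_iff[OF assms] Max_le_iff[OF fin(2) ne(2)] by blast
  \<comment> \<open>Nonnegativity makes the real maximum an admissible total and \<open>nat\<close>
    faithful on the integer one.\<close>
  have V0: "0 \<le> Max ?V"
    using Max_in[OF fin(1) ne(1)] partition_value_nonneg[of _ K P H] by fastforce
  have C0: "0 \<le> Max ?C"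
    using Max_in[OF fin(2) ne(2)] partition_value_nonneg[of _ K P H] by fastforce
  have "is_ps_min_sum_rate P K H \<alpha> \<longleftrightarrow> \<alpha> = Max ?V" for \<alpha>
    unfolding is_ps_min_sum_rate_def ps using V0 by (meson order_antisym order_refl order_trans)
  moreover have "is_nps_min_sum_rate P K H \<alpha> \<longleftrightarrow> int \<alpha> = Max ?C" for \<alpha>
  proof
    assume *: "is_nps_min_sum_rate P K H \<alpha>"
    then have "Max ?C \<le> int \<alpha>" unfolding is_nps_min_sum_rate_def nps by blast
    \<comment> \<open>Minimality is tested against the feasible total
      \<open>nat (Max ?C)\<close>.\<close>
    moreover have "\<alpha> \<le> nat (Max ?C)"
      using * C0 unfolding is_nps_min_sum_rate_def nps by simp
    ultimately show "int \<alpha> = Max ?C" using C0 by linarith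
  next
    assume "int \<alpha> = Max ?C"
    then show "is_nps_min_sum_rate P K H \<alpha>"
      unfolding is_nps_min_sum_rate_def nps by (metis of_nat_le_iff order_refl)
  qed
  moreover have "\<exists>!\<alpha>. int \<alpha> = Max ?C"
    using C0 by (intro ex1I[of _ "nat (Max ?C)"]) linarith+
  ultimately show ?thesis by simp
qed

end
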